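(* Let $m,n$ be positive integers, let $c_j\ge0$ and $d_{ij}\ge0$ ($i\in[m]$, $j\in[n]$) be real numbers, and let $\chi$ be the mixed-binary set defined in the context. (1) For any $I\subseteq[m]$, $J\subset[n]$ and $j'\in[n]\setminus J$, the inequality $$\sum_{i\in I}\sum_{j\in J\cup\{j'\}}x_{ij}-\Big(\sum_{i\in I}\max_{j\in[n]}d_{ij}-\sum_{j\in J}c_j\Big)y_{j'}\le\sum_{j\in J}c_j$$ is valid for $\mathrm{conv}(\chi)$. (2) If $d_{ij}>0$ for all $i\in[m]$, $j\in[n]$, and $I\subseteq[m]$, $J\subset[n]$ satisfy $\sum_{j\in J}c_j\le\sum_{i\in I}\max_{j\in J}d_{ij}$, then the inequality $$\sum_{i\in I}\sum_{j\in[n]}x_{ij}-\sum_{j'\in[n]\setminus J}\Big(\sum_{i\in I}\max_{j\in J\cup\{j'\}}d_{ij}-\sum_{j\in J}c_j\Big)y_{j'}\le\sum_{j\in J}c_j$$ is valid for $\mathrm{conv}(\chi)$. (3) If $I\subseteq[m]$ and $J\subseteq[n]$ satisfy $\sum_{j\in J}c_j>\sum_{i\in I}\max_{j\in J}d_{ij}$, $\max_{j\in[n]}d_{ij}=\max_{j\in J}d_{ij}$ for all $i\in I$, and $\sum_{j\in J\setminus\{j_0\}}c_j<\sum_{i\in I}\max_{j\in J\setminus\{j_0\}}d_{ij}$ for all $j_0\in J$, then the inequality $$\sum_{i\in I}\sum_{j\in J}x_{ij}+\sum_{j\in J}\Big(\sum_{j'\in J\setminus\{j\}}c_{j'}-\sum_{i\in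 I}\max_{j'\in J}d_{ij'}\Big)y_j\le(|J|-1)\Big(\sum_{j\in J}c_j-\sum_{i\in I}\max_{j'\in J}d_{ij'}\Big)$$ defines a facet of $\mathrm{conv}(\chi)$.
   Context: Notation: $[k]=\{1,\ldots,k\}$; a maximum over the empty set is taken to be $0$. The number $c_j$ is the capacity of a service center at location $j\in[n]$, and $d_{ij}$ is the demand attracted from customer site $i\in[m]$ by a service center at $j$. The set $\chi\subset\mathbb{R}^{mn}\times\mathbb{R}^n$ consists of all $[x,y]$, with $x=(x_{ij})$, $y=(y_j)$, $i\in[m]$, $j\in[n]$, satisfying $\sum_{i=1}^m x_{ij}\le c_jy_j$ for all $j\in[n]$; $\sum_{j=1}^n x_{ij}\le\max_{j\in[n]}d_{ij}y_j$ for all $i\in[m]$; $x_{ij}\ge0$, $y_j\in\{0,1\}$ for all $i\in[m]$, $j\in[n]$. An inequality is valid for a set if every point of the set satisfies it. An inequality defines a facet of a polytope $P$ if it is valid for $P$ and the set of points of $P$ satisfying it with equality has dimension $\dim P-1$. *)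

theory Defs
  imports "HOL-Analysis.Analysis"
begin

text \<open>The maximum of a family over a finite index set; over the empty set it is 0 by convention.\<close>

definition max_over :: "'a set \<Rightarrow> ('a \<Rightarrow> real) \<Rightarrow> real" where
  "max_over A f = (if A = {} then 0 else Max (f ` A))"

text \<open>Customer sites and locations are the elements of the finite types \<open>'m\<close> and \<open>'n\<close>, so that
  \<^term>\<open>UNIV\<close> plays the role of the index sets \<open>[m]\<close> and \<open>[n]\<close>.\<close>

definition chi :: "('n::finite \<Rightarrow> real) \<Rightarrow> ('m::finite \<Rightarrow> 'n \<Rightarrow> real) \<Rightarrow> ((real ^ 'n ^ 'm) \<times> (real ^ 'n)) set" where
  "chi c d = {(x, y).
     (\<forall>j. (\<Sum>i\<in>UNIV. x $ i $ j) \<le> c j * y $ j) \<and>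
     (\<forall>i. (\<Sum>j\<in>UNIV. x $ i $ j) \<le> max_over UNIV (\<lambda>j. d i j * y $ j)) \<and>
     (\<forall>i j. x $ i $ j \<ge> 0) \<and>
     (\<forall>j. y $ j \<in> {0, 1})}"

text \<open>An inequality is given by its left-hand side \<open>f\<close> and its constant right-hand side \<open>b\<close>.\<close>

definition valid_ineq :: "'a set \<Rightarrow> ('a \<Rightarrow> real) \<Rightarrow> real \<Rightarrow> bool" where
  "valid_ineq S f b \<longleftrightarrow> (\<forall>z\<in>S. f z \<le> b)"

definition defines_facet :: "'a::euclidean_space set \<Rightarrow> ('a \<Rightarrow> real) \<Rightarrow> real \<Rightarrow> bool" where
  "defines_facet P f b \<longleftrightarrow>
     valid_ineq P f b \<and> aff_dim {z \<in> P. f z = b} = aff_dim P - 1"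

end

theory Submission
  imports Defs
begin

text \<open>Validity only has to be checked on \<open>\<chi>\<close>. In (1) and (2) one bounds the total flow by capacity when
  the relevant centers outside \<open>J\<close> are closed and by demand otherwise; in (2) the increments
  \<open>max\<^bsub>J \<union> S\<^esub> - max\<^bsub>J\<^esub>\<close> are subadditive in \<open>S\<close>.

  For (3), the origin lies in \<open>\<chi>\<close> and off the hyperplane, so it suffices that every linear functional
  vanishing on the tight points vanishes on \<open>\<chi>\<close>. Tight points have either all of \<open>J\<close> open and the
  demand of \<open>I\<close> met from \<open>J\<close>, or exactly one center of \<open>J\<close> closed and the other capacities of \<open>J\<close>
  exhausted on \<open>I\<close>. Moving a little flow along a row in the first case and along a column in the
  second shows that the \<open>x\<close>-coefficients agree on \<open>I \<times> J\<close> and vanish elsewhere, up to coordinates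
  that are zero throughout \<open>\<chi>\<close>. The functional is then a multiple of the left-hand side, and the
  multiple is zero because the right-hand side is positive.\<close>

section \<open>Facets of convex hulls\<close>

lemma valid_ineq_convex_hull:
  assumes "linear f" "valid_ineq S f b"
  shows "valid_ineq (convex hull S) f b"
proof -
  have "convex (f -` {..b})"
    using assms(1) by (intro convex_linear_vimage) auto
  moreover have "S \<subseteq> f -` {..b}"
    using assms(2) by (auto simp: valid_ineq_def)
  ultimately have "convex hull S \<subseteq> f -` {..b}"
    by (simp add: hull_minimal)
  then show ?thesis
    by (auto simp: valid_ineq_def)
qed

text \<open>In a Euclidean space an affine hull is an intersection of hyperplanes, so containment
  can be tested one linear equation at a time.\<close>

lemma subset_affine_hullI:
  fixes A S :: "'a::euclidean_space set"
  assumes "\<And>u \<gamma>. \<forall>z\<in>A. u \<bullet> z = \<gamma> \<Longrightarrow> \<forall>z\<in>S. u \<bullet> z = \<gamma>"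
  shows "S \<subseteq> affine hull A"
proof -
  obtain H where hull: "\<Inter>H = affine hull A"
    and planes: "\<And>h. h \<in> H \<Longrightarrow> \<exists>u \<gamma>. u \<noteq> 0 \<and> h = {z. u \<bullet> z = \<gamma>}"
    using affine_hull_finite_intersection_hyperplanes[of A] by metis
  have "S \<subseteq> h" if h: "h \<in> H" for h
  proof -
    obtain u \<gamma> where u: "h = {z. u \<bullet> z = \<gamma>}"
      using planes[OF h] by blast
    have "A \<subseteq> h"
      using hull h hull_subset[of A affine] by blast
    then have "\<forall>z\<in>A. u \<bullet> z = \<gamma>"
      using u by auto
    then show ?thesis
      using assms u by auto
  qed
  then show ?thesis
    using hull by blast
qed

text \<open>Adjoining a point off the hyperplane raises the dimension of the face by exactly one.
  The condition on functionals says that the enlarged set already spans the affine hull of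
  \<open>S\<close>, so neither dimension has to be computed.\<close>

lemma defines_facet_convex_hullI:
  fixes S :: "'a::euclidean_space set"
  assumes lin: "linear f" and valid: "valid_ineq S f b"
    and p: "p \<in> S" "f p \<noteq> b"
    and span: "\<And>u \<gamma>. \<lbrakk>\<forall>z\<in>S. f z = b \<longrightarrow> u \<bullet> z = \<gamma>; u \<bullet> p = \<gamma>\<rbrakk> \<Longrightarrow> \<forall>z\<in>S. u \<bullet> z = \<gamma>"
  shows "defines_facet (convex hull S) f b"
proof -
  define F where "F = {z \<in> convex hull S. f z = b}"
  have "affine (f -` {b})"
    using lin by (auto simp: affine_def linear_add linear_scale simp flip: distrib_right)
  then have "affine hull F \<subseteq> f -` {b}"
    by (intro hull_minimal) (auto simp: F_def)
  then have p_notin: "p \<notin> affine hull F"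
    using p by auto
  have "S \<subseteq> affine hull (insert p F)"
  proof (rule subset_affine_hullI)
    fix u \<gamma> assume *: "\<forall>z\<in>insert p F. u \<bullet> z = \<gamma>"
    have "\<forall>z\<in>S. f z = b \<longrightarrow> u \<bullet> z = \<gamma>"
      using * by (auto simp: F_def hull_inc)
    then show "\<forall>z\<in>S. u \<bullet> z = \<gamma>"
      using span * by blast
  qed
  then have "aff_dim S \<le> aff_dim (insert p F)"
    using aff_dim_subset[of S "affine hull (insert p F)"] by simp
  moreover have "insert p F \<subseteq> convex hull S"
    using p by (auto simp: F_def hull_inc)
  then have "aff_dim (insert p F) \<le> aff_dim S"
    using aff_dim_subset aff_dim_convex_hull by metis
  ultimately have "aff_dim F = aff_dim (convex hull S) - 1"
    using p_notin by (simp add: aff_dim_insert aff_dim_convex_hull)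
  then show ?thesis
    using valid_ineq_convex_hull[OF lin valid] by (simp add: defines_facet_def F_def)
qed

section \<open>Maxima over finite sets\<close>

lemma max_over_empty [simp]: "max_over {} f = 0"
  by (simp add: max_over_def)

lemma max_over_ge: "finite A \<Longrightarrow> a \<in> A \<Longrightarrow> f a \<le> max_over A f"
  by (auto simp: max_over_def)

lemma max_over_least: "finite A \<Longrightarrow> (\<And>a. a \<in> A \<Longrightarrow> f a \<le> u) \<Longrightarrow> 0 \<le> u \<Longrightarrow> max_over A f \<le> u"
  by (auto simp: max_over_def)

lemma max_over_nonneg: "finite A \<Longrightarrow> (\<And>a. a \<in> A \<Longrightarrow> 0 \<le> f a) \<Longrightarrow> 0 \<le> max_over A f"
  by (cases "A = {}") (auto intro: order_trans[OF _ max_over_ge])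

lemma max_over_mono:
  assumes "finite B" "A \<subseteq> B" "\<And>a. a \<in> A \<Longrightarrow> f a \<le> g a" "\<And>b. b \<in> B \<Longrightarrow> 0 \<le> g b"
  shows "max_over A f \<le> max_over B g"
proof (rule max_over_least)
  show "finite A" using assms finite_subset by blast
  show "0 \<le> max_over B g" using assms by (intro max_over_nonneg)
  fix a assume "a \<in> A"
  then show "f a \<le> max_over B g"
    using assms max_over_ge[of B a g] order_trans by blast
qed

text \<open>Each value of \<open>f\<close> on \<open>A \<union> S\<close> is bounded either by the
  maximum over \<open>A\<close> or by a single increment added to it. The remaining increments are
  nonnegative.\<close>

lemma max_over_Un_sum_le:
  assumes "finite A" "finite S" and nn: "\<And>a. 0 \<le> f a"
  shows "max_over (A \<union> S) f \<le> max_over A f + (\<Sum>s\<in>S. max_over (A \<union> {s}) f - max_over A f)"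
proof (rule max_over_least)
  have incr: "0 \<le> max_over (A \<union> {s}) f - max_over A f" for s
    using assms max_over_mono[of "A \<union> {s}" A f f] by auto
  then have sum_nn: "0 \<le> (\<Sum>s\<in>S. max_over (A \<union> {s}) f - max_over A f)"
    by (intro sum_nonneg)
  show "0 \<le> max_over A f + (\<Sum>s\<in>S. max_over (A \<union> {s}) f - max_over A f)"
    using sum_nn max_over_nonneg[of A f] assms by simp
  fix a assume a: "a \<in> A \<union> S"
  show "f a \<le> max_over A f + (\<Sum>s\<in>S. max_over (A \<union> {s}) f - max_over A f)"
  proof (cases "a \<in> A")
    case True
    then show ?thesis
      using max_over_ge[of A a f] sum_nn assms by linarith
  next
    case False
    then have "max_over (A \<union> {a}) f - max_over A f \<le> (\<Sum>s\<in>S. max_over (A \<union> {s}) f - max_over A f)"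
      using a assms incr by (intro member_le_sum) auto
    then show ?thesis
      using max_over_ge[of "A \<union> {a}" a f] assms by simp
  qed
qed (use assms in auto)

text \<open>A maximizer cannot equal both \<open>a\<close> and \<open>b\<close>, and deleting a
  point different from it preserves the maximum.\<close>

lemma max_over_Diff_cases:
  assumes "finite A" "a \<noteq> b" and nn: "\<And>x. 0 \<le> f x"
  shows "max_over A f = max_over (A - {a}) f \<or> max_over A f = max_over (A - {b}) f"
proof (cases "A = {}")
  case False
  then have "Max (f ` A) \<in> f ` A"
    using assms(1) by (intro Max_in) auto
  then obtain x where x: "x \<in> A" "max_over A f = f x"
    using False by (auto simp: max_over_def)
  have "max_over A f = max_over (A - {y}) f" if "x \<noteq> y" for y
    using x that max_over_ge[of "A - {y}" x f] max_over_mono[of A "A - {y}" f f] assms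
    by (intro antisym) auto
  then show ?thesis
    using assms(2) by metis
qed simp

section \<open>Points of the mixed-binary set\<close>

lemma chiD:
  assumes "(x, y) \<in> chi c d"
  shows "(\<Sum>i\<in>UNIV. x $ i $ j) \<le> c j * y $ j"
    and "(\<Sum>j\<in>UNIV. x $ i $ j) \<le> max_over UNIV (\<lambda>j. d i j * y $ j)"
    and "0 \<le> x $ i $ j"
    and "y $ j = 0 \<or> y $ j = 1"
  using assms by (auto simp: chi_def)

lemma chi_col_le:
  assumes "(x, y) \<in> chi c d"
  shows "(\<Sum>i\<in>I. x $ i $ j) \<le> c j * y $ j"
  using chiD[OF assms] sum_mono2[of UNIV I "\<lambda>i. x $ i $ j"] by (force intro: order_trans)

lemma chi_row_le:
  assumes "(x, y) \<in> chi c d"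
  shows "(\<Sum>j\<in>J. x $ i $ j) \<le> max_over UNIV (\<lambda>j. d i j * y $ j)"
  using chiD[OF assms] sum_mono2[of UNIV J "\<lambda>j. x $ i $ j"] by (force intro: order_trans)

lemma chi_row_cap_le:
  assumes z: "(x, y) \<in> chi c d" and nn: "\<And>j. 0 \<le> d i j"
    and T: "\<And>j. j \<notin> T \<Longrightarrow> y $ j = 0"
  shows "max_over UNIV (\<lambda>j. d i j * y $ j) \<le> max_over T (d i)"
proof (rule max_over_least)
  show nn': "0 \<le> max_over T (d i)"
    using nn by (intro max_over_nonneg) auto
  fix j
  show "d i j * y $ j \<le> max_over T (d i)"
  proof (cases "j \<in> T")
    case True
    then have "d i j \<le> max_over T (d i)" by (intro max_over_ge) auto
    then show ?thesis
      using chiD(4)[OF z, of j] nn' by auto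
  qed (use T nn' in auto)
qed simp

lemma chi_sum_le:
  assumes z: "(x, y) \<in> chi c d" and nn: "\<And>i j. 0 \<le> d i j"
    and T: "\<And>j. j \<notin> T \<Longrightarrow> y $ j = 0"
  shows "(\<Sum>i\<in>I. \<Sum>j\<in>J. x $ i $ j) \<le> (\<Sum>i\<in>I. max_over T (d i))"
  using chi_row_le[OF z] chi_row_cap_le[OF z nn T] by (intro sum_mono) (force intro: order_trans)

lemma chi_sum_le_capacity:
  assumes z: "(x, y) \<in> chi c d"
  shows "(\<Sum>i\<in>I. \<Sum>j\<in>J. x $ i $ j) \<le> (\<Sum>j\<in>J. c j * y $ j)"
  by (subst sum.swap) (intro sum_mono chi_col_le[OF z])

text \<open>Handles the coordinates on which a functional vanishing on the tight points may have an
  arbitrary coefficient.\<close>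

lemma chi_entry_eq_0:
  assumes z: "(x, y) \<in> chi c d" and "c j * y $ j \<le> 0 \<or> max_over UNIV (\<lambda>j. d i j * y $ j) \<le> 0"
  shows "x $ i $ j = 0"
  using chi_col_le[OF z, of j "{i}"] chi_row_le[OF z, of i "{j}"] chiD(3)[OF z, of i j] assms(2)
  by auto

lemma axis_axis_nth: "axis k (axis l e) $ i $ j = (if i = k \<and> j = l then e else 0)"
  by (simp add: axis_def)

lemma row_sum_axis: "(\<Sum>j\<in>UNIV. (axis k (axis l e) :: 'a::comm_monoid_add^'n^'m) $ i $ j) = (if i = k then e else 0)"
  by (simp add: axis_def)

lemma col_sum_axis: "(\<Sum>i\<in>UNIV. (axis k (axis l e) :: 'a::comm_monoid_add^'n^'m) $ i $ j) = (if j = l then e else 0)"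
  by (cases "j = l") (simp_all add: axis_axis_nth)

lemma block_sum_axis:
  "(\<Sum>i\<in>I. \<Sum>j\<in>J. (axis k (axis l e) :: 'a::comm_monoid_add^'n^'m) $ i $ j)
    = (if k \<in> I \<and> l \<in> J then e else 0)"
proof -
  have "(\<Sum>j\<in>J. (axis k (axis l e) :: 'a^'n^'m) $ i $ j) = (if i = k then if l \<in> J then e else 0 else 0)" for i
    by (simp add: axis_def)
  then show ?thesis
    by simp
qed

text \<open>Here \<open>e\<close> may be negative: applying this twice, first removing and then
  adding, moves flow from one entry to another.\<close>

lemma chi_add_entry:
  assumes "(x, y) \<in> chi c d" "0 \<le> x $ k $ l + e"
    and "(\<Sum>j\<in>UNIV. x $ k $ j) + e \<le> max_over UNIV (\<lambda>j. d k j * y $ j)"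
    and "(\<Sum>i\<in>UNIV. x $ i $ l) + e \<le> c l * y $ l"
  shows "(x + axis k (axis l e), y) \<in> chi c d"
proof -
  have "0 \<le> (x + axis k (axis l e)) $ i $ j" for i j
    using assms(2) chiD(3)[OF assms(1)] by (simp add: axis_axis_nth)
  then show ?thesis
    using assms by (auto simp: chi_def sum.distrib row_sum_axis col_sum_axis)
qed

definition ind :: "'n set \<Rightarrow> real ^ 'n" where
  "ind S = (\<chi> j. if j \<in> S then 1 else 0)"

lemma ind_nth [simp]: "ind S $ j = (if j \<in> S then 1 else 0)"
  by (simp add: ind_def)

lemma inner_ind: "v \<bullet> ind S = (\<Sum>j\<in>S. v $ j)"
  by (simp add: inner_vec_def if_distrib sum.If_cases cong: if_cong)

lemma max_over_ind_ge:
  fixes d :: "'n::finite \<Rightarrow> real"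
  assumes "T \<subseteq> S" "\<And>j. 0 \<le> d j"
  shows "max_over T d \<le> max_over UNIV (\<lambda>j. d j * ind S $ j)"
  using assms by (intro max_over_mono) auto

text \<open>Supplies the point off the hyperplane for the facet criterion.\<close>

lemma zero_in_chi:
  assumes "\<And>j. 0 \<le> c j" "\<And>i j. 0 \<le> d i j"
  shows "(0, 0) \<in> chi c d"
  by (auto simp: chi_def intro!: max_over_nonneg)

section \<open>The flow-cover type facet\<close>

locale flow_cover =
  fixes c :: "'n::finite \<Rightarrow> real" and d :: "'m::finite \<Rightarrow> 'n \<Rightarrow> real"
    and I :: "'m set" and J :: "'n set"
  assumes c_nonneg: "\<And>j. 0 \<le> c j" and d_nonneg: "\<And>i j. 0 \<le> d i j"
    and excess: "(\<Sum>i\<in>I. max_over J (d i)) < (\<Sum>j\<in>J. c j)"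
    and dominated: "\<And>i. i \<in> I \<Longrightarrow> max_over UNIV (d i) = max_over J (d i)"
    and minimal: "\<And>j0. j0 \<in> J \<Longrightarrow> (\<Sum>j\<in>J - {j0}. c j) < (\<Sum>i\<in>I. max_over (J - {j0}) (d i))"
begin

abbreviation dem :: "'n set \<Rightarrow> 'm \<Rightarrow> real" where
  "dem T i \<equiv> max_over T (d i)"

abbreviation C :: real where
  "C \<equiv> \<Sum>j\<in>J. c j"

abbreviation D :: real where
  "D \<equiv> \<Sum>i\<in>I. dem J i"

text \<open>For \<open>j\<close> in \<open>J\<close> the coefficient of \<open>y $ j\<close> equals
  \<open>(C - D) - c j\<close>, the form in which it is used below.\<close>

definition lhs :: "(real ^ 'n ^ 'm) \<times> (real ^ 'n) \<Rightarrow> real" where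
  "lhs = (\<lambda>(x, y). (\<Sum>i\<in>I. \<Sum>j\<in>J. x $ i $ j) + (\<Sum>j\<in>J. ((\<Sum>j'\<in>J - {j}. c j') - D) * y $ j))"

definition rhs :: real where
  "rhs = (real (card J) - 1) * (C - D)"

lemma linear_lhs: "linear lhs"
  by (rule linearI)
    (auto simp: lhs_def sum.distrib algebra_simps sum_distrib_left sum_subtractf)

lemma dem_nonneg: "0 \<le> dem T i"
  using d_nonneg by (intro max_over_nonneg) auto

lemma dem_mono: "T \<subseteq> S \<Longrightarrow> dem T i \<le> dem S i"
  using d_nonneg by (intro max_over_mono) auto

lemma D_nonneg: "0 \<le> D"
  by (intro sum_nonneg dem_nonneg)

lemma C_pos: "0 < C"
  using D_nonneg excess by linarith

lemma sum_c_remove: "j0 \<in> J \<Longrightarrow> (\<Sum>j\<in>J - {j0}. c j) = C - c j0"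
  by (simp add: sum_diff1)

text \<open>By \<open>minimal\<close>, \<open>C - c j0\<close> is below the demand that remains
  without \<open>j0\<close>, and this is at most \<open>D\<close>.\<close>

lemma excess_less_c:
  assumes "j0 \<in> J"
  shows "C - D < c j0"
proof -
  have "(\<Sum>i\<in>I. dem (J - {j0}) i) \<le> D"
    by (intro sum_mono dem_mono) auto
  then show ?thesis
    using minimal[OF assms] sum_c_remove[OF assms] by linarith
qed

lemma c_pos: "j \<in> J \<Longrightarrow> 0 < c j"
  using excess_less_c[of j] excess by linarith

lemma dem_remove_pos: "j0 \<in> J \<Longrightarrow> 0 < (\<Sum>i\<in>I. dem (J - {j0}) i)"
  using minimal[of j0] sum_nonneg[of "J - {j0}" c] c_nonneg by fastforce

text \<open>The empty maximum is 0, so for a singleton \<open>J\<close> the remaining demand would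
  be 0, against \<open>dem_remove_pos\<close>.\<close>

lemma J_remove_nonempty: "j0 \<in> J \<Longrightarrow> J - {j0} \<noteq> {}"
proof
  assume "j0 \<in> J" and empty: "J - {j0} = {}"
  then have "0 < (\<Sum>i\<in>I. dem (J - {j0}) i)" by (intro dem_remove_pos)
  then show False unfolding empty by simp
qed

lemma J_two_elements:
  obtains a b where "a \<in> J" "b \<in> J" "a \<noteq> b"
proof -
  have "J \<noteq> {}" using C_pos by auto
  then obtain a where "a \<in> J" by blast
  then show ?thesis using J_remove_nonempty[of a] that by blast
qed

lemma card_J: "1 < card J"
proof -
  obtain a b where "a \<in> J" "b \<in> J" "a \<noteq> b" by (rule J_two_elements)
  then have "card {a, b} \<le> card J" by (intro card_mono) auto
  then show ?thesis using \<open>a \<noteq> b\<close> by simp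
qed

lemma rhs_pos: "0 < rhs"
  using card_J excess by (simp add: rhs_def)

text \<open>With \<open>k\<close> open centers in \<open>J\<close>, the left-hand side is the flow
  minus the open capacity of \<open>J\<close>, plus \<open>(C - D) * k\<close>. If all of
  \<open>J\<close> is open, the flow is at most \<open>D\<close>; otherwise it is at most the open
  capacity, and \<open>k\<close> is at most \<open>card J - 1\<close>.\<close>

lemma valid_lhs: "valid_ineq (chi c d) lhs rhs"
  unfolding valid_ineq_def
proof (clarify)
  fix x :: "real ^ 'n ^ 'm" and y :: "real ^ 'n"
  assume z: "(x, y) \<in> chi c d"
  define k where "k = (\<Sum>j\<in>J. y $ j)"
  have "(\<Sum>j\<in>J. ((\<Sum>j'\<in>J - {j}. c j') - D) * y $ j) = (\<Sum>j\<in>J. (C - D) * y $ j - c j * y $ j)"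
    by (intro sum.cong refl) (simp add: sum_c_remove algebra_simps)
  then have lhs: "lhs (x, y) = (\<Sum>i\<in>I. \<Sum>j\<in>J. x $ i $ j) + (C - D) * k - (\<Sum>j\<in>J. c j * y $ j)"
    by (simp add: lhs_def k_def sum_subtractf sum_distrib_left)
  show "lhs (x, y) \<le> rhs"
  proof (cases "\<forall>j\<in>J. y $ j = 1")
    case True
    have "(\<Sum>i\<in>I. \<Sum>j\<in>J. x $ i $ j) \<le> (\<Sum>i\<in>I. dem UNIV i)"
      using d_nonneg by (intro chi_sum_le[OF z]) auto
    also have "\<dots> = D"
      using dominated by simp
    finally show ?thesis
      using True by (simp add: lhs rhs_def k_def algebra_simps)
  next
    case False
    then obtain j0 where j0: "j0 \<in> J" "y $ j0 = 0"
      using chiD(4)[OF z] by metis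
    have "k = (\<Sum>j\<in>J - {j0}. y $ j)"
      using j0 by (simp add: k_def sum_diff1)
    also have "\<dots> \<le> real (card (J - {j0}))"
    proof -
      have "y $ j \<le> 1" for j using chiD(4)[OF z, of j] by auto
      then show ?thesis using sum_bounded_above[of "J - {j0}" "\<lambda>j. y $ j" 1] by simp
    qed
    also have "\<dots> = real (card J) - 1"
      using j0 card_J by (simp add: card_Diff_singleton of_nat_diff)
    finally have "(C - D) * k \<le> (C - D) * (real (card J) - 1)"
      using excess by (intro mult_left_mono) auto
    then show ?thesis
      using chi_sum_le_capacity[OF z, of J I] by (simp add: lhs rhs_def algebra_simps)
  qed
qed

section \<open>Proportional flow plans\<close>

text \<open>A matrix of rank at most one, proportional to capacity along rows and to demand along
  columns, which makes all its row and column sums explicit.\<close>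

definition plan :: "'n set \<Rightarrow> real \<Rightarrow> real ^ 'n ^ 'm" where
  "plan T s = (\<chi> i j. if i \<in> I \<and> j \<in> T then s * c j * dem T i else 0)"

lemma plan_nth: "plan T s $ i $ j = (if i \<in> I \<and> j \<in> T then s * c j * dem T i else 0)"
  by (simp add: plan_def)

lemma plan_row: "(\<Sum>j\<in>UNIV. plan T s $ i $ j) = (if i \<in> I then s * (\<Sum>j\<in>T. c j) * dem T i else 0)"
  by (simp add: plan_nth sum.If_cases sum_distrib_left sum_distrib_right)

lemma plan_col: "(\<Sum>i\<in>UNIV. plan T s $ i $ j) = (if j \<in> T then s * (\<Sum>i\<in>I. dem T i) * c j else 0)"
  by (simp add: plan_nth sum.If_cases sum_distrib_left sum_distrib_right ac_simps)

lemma plan_block: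
  assumes "T \<subseteq> J"
  shows "(\<Sum>i\<in>I. \<Sum>j\<in>J. plan T s $ i $ j) = s * (\<Sum>j\<in>T. c j) * (\<Sum>i\<in>I. dem T i)"
proof -
  have "(\<Sum>j\<in>J. plan T s $ i $ j) = s * (\<Sum>j\<in>T. c j) * dem T i" if "i \<in> I" for i
    using that assms by (simp add: plan_nth sum.If_cases Int_absorb1 sum_distrib_left sum_distrib_right)
  then show ?thesis
    by (simp add: sum_distrib_left)
qed

text \<open>The bounds on \<open>s\<close> say which fraction is used: \<open>s\<close> times the
  capacity of \<open>T\<close> in each row of \<open>I\<close>, and \<open>s\<close> times the
  demand of \<open>I\<close> in each column of \<open>T\<close>.\<close>

lemma plan_in_chi:
  assumes T: "T \<subseteq> S" and s: "0 \<le> s" "s * (\<Sum>j\<in>T. c j) \<le> 1" "s * (\<Sum>i\<in>I. dem T i) \<le> 1"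
  shows "(plan T s, ind S) \<in> chi c d"
proof -
  have "s * (\<Sum>j\<in>T. c j) * dem T i \<le> max_over UNIV (\<lambda>j. d i j * ind S $ j)" for i
    using mult_right_mono[OF s(2) dem_nonneg[of T i]] max_over_ind_ge[OF T, of "d i"] d_nonneg by simp
  moreover have "0 \<le> max_over UNIV (\<lambda>j. d i j * ind S $ j)" for i
    using d_nonneg by (intro max_over_nonneg) auto
  moreover have "s * (\<Sum>i\<in>I. dem T i) * c j \<le> c j" for j
    using mult_right_mono[OF s(3) c_nonneg[of j]] by simp
  moreover have "0 \<le> plan T s $ i $ j" for i j
    using s c_nonneg dem_nonneg by (simp add: plan_nth)
  ultimately show ?thesis
    using T c_nonneg by (auto simp: chi_def plan_row plan_col simp del: ind_nth) (auto simp: subset_eq)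
qed

section \<open>Tight points\<close>

definition tight :: "((real ^ 'n ^ 'm) \<times> (real ^ 'n)) set" where
  "tight = {z \<in> chi c d. lhs z = rhs}"

text \<open>This is the contribution of \<open>y\<close> when all of \<open>J\<close> is open, so
  that tightness then means a flow of exactly \<open>D\<close>.\<close>

lemma coeff_sum: "(\<Sum>j\<in>J. (\<Sum>j'\<in>J - {j}. c j') - D) = rhs - D"
proof -
  have "(\<Sum>j\<in>J. (\<Sum>j'\<in>J - {j}. c j') - D) = (\<Sum>j\<in>J. (C - D) - c j)"
    by (intro sum.cong refl) (simp add: sum_c_remove)
  also have "\<dots> = rhs - D"
    by (simp add: sum_subtractf sum.distrib rhs_def algebra_simps)
  finally show ?thesis .
qed

lemma tight_fullI:
  assumes "(x, ind S) \<in> chi c d" "J \<subseteq> S" "(\<Sum>i\<in>I. \<Sum>j\<in>J. x $ i $ j) = D"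
  shows "(x, ind S) \<in> tight"
proof -
  have "(\<Sum>j\<in>J. ((\<Sum>j'\<in>J - {j}. c j') - D) * ind S $ j) = (\<Sum>j\<in>J. (\<Sum>j'\<in>J - {j}. c j') - D)"
    using assms(2) by (intro sum.cong) auto
  then show ?thesis
    using assms by (simp add: tight_def lhs_def coeff_sum)
qed

lemma tight_removeI:
  assumes "(x, ind (- {j0})) \<in> chi c d" "j0 \<in> J"
    and "(\<Sum>i\<in>I. \<Sum>j\<in>J. x $ i $ j) = (\<Sum>j\<in>J - {j0}. c j)"
  shows "(x, ind (- {j0})) \<in> tight"
proof -
  have "(\<Sum>j\<in>J. ((\<Sum>j'\<in>J - {j}. c j') - D) * ind (- {j0}) $ j)
      = (\<Sum>j\<in>J - {j0}. (\<Sum>j'\<in>J - {j}. c j') - D)"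
    by (intro sum.mono_neutral_cong_right) auto
  also have "\<dots> = rhs - (\<Sum>j\<in>J - {j0}. c j)"
    using coeff_sum sum.remove[OF _ assms(2), of "\<lambda>j. (\<Sum>j'\<in>J - {j}. c j') - D"] by simp
  finally show ?thesis
    using assms by (simp add: tight_def lhs_def)
qed

text \<open>With every center of \<open>J\<close> open, the plan meets all demand of \<open>I\<close> and leaves slack in every
  column of positive capacity; with one center closed, it exhausts the open capacities and leaves slack in every row
  with positive demand.\<close>

definition full_plan :: "real ^ 'n ^ 'm" where
  "full_plan = plan J (1 / C)"

definition remove_plan :: "'n \<Rightarrow> real ^ 'n ^ 'm" where
  "remove_plan j0 = plan (J - {j0}) (1 / (\<Sum>i\<in>I. dem (J - {j0}) i))"

lemma full_plan_in_chi: "J \<subseteq> S \<Longrightarrow> (full_plan, ind S) \<in> chi c d"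
  unfolding full_plan_def using C_pos excess by (intro plan_in_chi) (auto simp: divide_simps)

lemma full_plan_block: "(\<Sum>i\<in>I. \<Sum>j\<in>J. full_plan $ i $ j) = D"
  using C_pos by (simp add: full_plan_def plan_block)

lemma full_plan_tight: "J \<subseteq> S \<Longrightarrow> (full_plan, ind S) \<in> tight"
  by (intro tight_fullI full_plan_in_chi full_plan_block)

text \<open>A column of \<open>J\<close> uses the fraction \<open>D / C < 1\<close> of its capacity;
  the other columns are empty.\<close>

lemma full_plan_col_less:
  assumes "0 < c j"
  shows "(\<Sum>i\<in>UNIV. full_plan $ i $ j) < c j"
proof -
  have "D / C * c j < 1 * c j"
    using assms C_pos excess by (intro mult_strict_right_mono) auto
  then show ?thesis
    using assms by (simp add: full_plan_def plan_col)
qed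

lemma remove_plan_in_chi: "j0 \<in> J \<Longrightarrow> (remove_plan j0, ind (- {j0})) \<in> chi c d"
  unfolding remove_plan_def using dem_remove_pos[of j0] minimal[of j0]
  by (intro plan_in_chi) (auto simp: divide_simps)

lemma remove_plan_block:
  assumes "j0 \<in> J"
  shows "(\<Sum>i\<in>I. \<Sum>j\<in>J. remove_plan j0 $ i $ j) = (\<Sum>j\<in>J - {j0}. c j)"
proof -
  have "(\<Sum>i\<in>I. dem (J - {j0}) i) \<noteq> 0"
    using dem_remove_pos[OF assms] by simp
  then show ?thesis
    by (simp add: remove_plan_def plan_block)
qed

lemma remove_plan_tight: "j0 \<in> J \<Longrightarrow> (remove_plan j0, ind (- {j0})) \<in> tight"
  by (intro tight_removeI remove_plan_in_chi remove_plan_block)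

text \<open>By \<open>minimal\<close> the open capacity of \<open>J\<close> is a proper fraction of
  the demand that \<open>J - {j0}\<close> attracts from \<open>I\<close>, and each row of
  \<open>I\<close> is filled to that same fraction.\<close>

lemma remove_plan_row_less:
  assumes "j0 \<in> J" "i \<in> I" "0 < dem (J - {j0}) i"
  shows "(\<Sum>j\<in>UNIV. remove_plan j0 $ i $ j) < max_over UNIV (\<lambda>j. d i j * ind (- {j0}) $ j)"
proof -
  have "(\<Sum>j\<in>J - {j0}. c j) / (\<Sum>i\<in>I. dem (J - {j0}) i) * dem (J - {j0}) i < 1 * dem (J - {j0}) i"
    using assms minimal[OF assms(1)] dem_remove_pos[OF assms(1)] by (intro mult_strict_right_mono) auto
  moreover have "dem (J - {j0}) i \<le> max_over UNIV (\<lambda>j. d i j * ind (- {j0}) $ j)"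
    using d_nonneg by (intro max_over_ind_ge) auto
  ultimately show ?thesis
    using assms(2) by (simp add: remove_plan_def plan_row del: ind_nth)
qed

section \<open>Functionals vanishing on the tight points\<close>

text \<open>Otherwise in each row of \<open>I\<close> one of the two reduced demands vanishes, so
  together they total at most \<open>D\<close>. By \<open>minimal\<close> this total exceeds
  \<open>2 * C - c a - c b\<close>, which is at least \<open>C\<close>, contradicting
  \<open>D < C\<close>.\<close>

lemma exists_common_row:
  assumes "a \<in> J" "b \<in> J" "a \<noteq> b"
  obtains k where "k \<in> I" "0 < dem (J - {a}) k" "0 < dem (J - {b}) k"
proof (rule ccontr)
  note obtained = that
  assume "\<not> thesis"
  then have none: "\<not> (0 < dem (J - {a}) k \<and> 0 < dem (J - {b}) k)" if "k \<in> I" for k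
    using that obtained \<open>\<not> thesis\<close> by blast
  have "dem (J - {a}) i + dem (J - {b}) i \<le> dem J i" if "i \<in> I" for i
    using none[OF that] dem_nonneg[of "J - {a}" i] dem_nonneg[of "J - {b}" i]
      dem_mono[of "J - {a}" J i] dem_mono[of "J - {b}" J i] by force
  then have "(\<Sum>i\<in>I. dem (J - {a}) i) + (\<Sum>i\<in>I. dem (J - {b}) i) \<le> D"
    by (simp add: sum_mono flip: sum.distrib)
  moreover have "c a + c b \<le> C"
    using assms c_nonneg sum_mono2[of J "{a, b}" c] by simp
  ultimately show False
    using minimal[of a] minimal[of b] excess assms by (simp add: sum_c_remove)
qed

text \<open>There is no constant term because the functional is normalized by its value at the
  origin.\<close>

lemma functional_vanishes:
  fixes A :: "real ^ 'n ^ 'm" and B :: "real ^ 'n"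
  assumes ann: "\<And>x y. (x, y) \<in> tight \<Longrightarrow> A \<bullet> x + B \<bullet> y = 0"
    and z: "(x, y) \<in> chi c d"
  shows "A \<bullet> x + B \<bullet> y = 0"
proof -
  \<comment> \<open>\<open>full_plan\<close> uses no column outside \<open>J\<close>, so it stays
    tight whether \<open>j\<close> is open or closed.\<close>
  have B_out: "B $ j = 0" if "j \<notin> J" for j
  proof -
    have "A \<bullet> full_plan + B \<bullet> ind UNIV = 0" "A \<bullet> full_plan + B \<bullet> ind (UNIV - {j}) = 0"
      using that by (auto intro!: ann full_plan_tight)
    then show ?thesis
      by (simp add: inner_ind sum_diff1)
  qed

  have inner_axes: "A \<bullet> axis k (axis l e) = A $ k $ l * e" for k l e
    by (simp add: inner_axis)

  \<comment> \<open>Row \<open>i\<close> is empty in \<open>full_plan\<close> and does not enter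
    \<open>lhs\<close>, so a small flow \<open>e\<close> can be placed there within the slack of
    column \<open>j\<close>.\<close>
  have A_out: "A $ i $ j = 0" if i: "i \<notin> I" and j: "0 < c j" and dem: "0 < dem UNIV i" for i j
  proof -
    define e where "e = min (dem UNIV i) (c j - (\<Sum>i\<in>UNIV. full_plan $ i $ j))"
    have e: "0 < e"
      using dem full_plan_col_less[OF j] by (simp add: e_def)
    have "(full_plan + axis i (axis j e), ind UNIV) \<in> chi c d"
      using i e by (intro chi_add_entry full_plan_in_chi) (auto simp: full_plan_def plan_row plan_nth e_def)
    then have "(full_plan + axis i (axis j e), ind UNIV) \<in> tight"
      using i by (intro tight_fullI) (auto simp: sum.distrib full_plan_block block_sum_axis)
    then have "A \<bullet> (full_plan + axis i (axis j e)) + B \<bullet> ind UNIV = 0"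
      by (rule ann)
    moreover have "A \<bullet> full_plan + B \<bullet> ind UNIV = 0"
      by (intro ann full_plan_tight) simp
    ultimately have "A $ i $ j * e = 0"
      by (simp only: inner_add_right inner_axes)
    then show ?thesis
      using e by simp
  qed

  \<comment> \<open>Flow \<open>e\<close> moves from \<open>j'\<close> to \<open>j\<close> within
    row \<open>i\<close>, which keeps the total at \<open>D\<close>; column \<open>j\<close> has
    slack. The intermediate point \<open>x1\<close>, after removal, need only lie in
    \<open>chi c d\<close>, not be tight.\<close>
  have A_row: "A $ i $ j = A $ i $ j'"
    if i: "i \<in> I" and j: "j \<in> J" "j' \<in> J" and dem: "0 < dem J i" for i j j'
  proof (cases "j = j'")
    case False
    define e where "e = min (full_plan $ i $ j') (c j - (\<Sum>i\<in>UNIV. full_plan $ i $ j))"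
    have "0 < full_plan $ i $ j'"
      using i j dem C_pos c_pos by (simp add: full_plan_def plan_nth)
    then have e: "0 < e" "e \<le> full_plan $ i $ j'" "(\<Sum>i\<in>UNIV. full_plan $ i $ j) + e \<le> c j"
      using full_plan_col_less[OF c_pos[OF j(1)]] by (auto simp: e_def)
    define x1 where "x1 = full_plan + axis i (axis j' (- e))"
    have fp: "(full_plan, ind UNIV) \<in> chi c d"
      by (intro full_plan_in_chi) auto
    have x1: "(x1, ind UNIV) \<in> chi c d"
      unfolding x1_def using e chiD(1)[OF fp, of j'] chiD(2)[OF fp, of i]
      by (intro chi_add_entry fp) (auto simp del: ind_nth)
    have row: "(\<Sum>j\<in>UNIV. x1 $ i $ j) + e = (\<Sum>j\<in>UNIV. full_plan $ i $ j)"
      by (simp add: x1_def sum.distrib row_sum_axis del: axis_nth)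
    have col: "(\<Sum>i\<in>UNIV. x1 $ i $ j) = (\<Sum>i\<in>UNIV. full_plan $ i $ j)"
      using False by (simp add: x1_def sum.distrib col_sum_axis)
    have "(x1 + axis i (axis j e), ind UNIV) \<in> chi c d"
      using e chiD(2)[OF fp, of i] chiD(3)[OF x1, of i j]
      by (intro chi_add_entry x1) (auto simp: row col)
    then have "(x1 + axis i (axis j e), ind UNIV) \<in> tight"
      using i j by (intro tight_fullI) (auto simp: x1_def sum.distrib full_plan_block block_sum_axis)
    then have "A \<bullet> (x1 + axis i (axis j e)) + B \<bullet> ind UNIV = 0"
      by (rule ann)
    moreover have "A \<bullet> full_plan + B \<bullet> ind UNIV = 0"
      by (intro ann full_plan_tight) simp
    ultimately have "A $ i $ j * e = A $ i $ j' * e"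
      unfolding x1_def inner_add_right inner_axes by linarith
    then show ?thesis
      using e by simp
  qed simp

  \<comment> \<open>The transposed move with \<open>j0\<close> closed: column \<open>j\<close> stays
    exhausted while row \<open>i\<close> absorbs the flow taken from row \<open>i'\<close>.\<close>
  have A_col: "A $ i $ j = A $ i' $ j"
    if j0: "j0 \<in> J" and j: "j \<in> J - {j0}" and i: "i \<in> I" "i' \<in> I"
      and dem: "0 < dem (J - {j0}) i" "0 < dem (J - {j0}) i'" for i i' j j0
  proof (cases "i = i'")
    case False
    define e where "e = min (remove_plan j0 $ i' $ j)
      (max_over UNIV (\<lambda>j. d i j * ind (- {j0}) $ j) - (\<Sum>j\<in>UNIV. remove_plan j0 $ i $ j))"
    have "0 < remove_plan j0 $ i' $ j"
      using i j dem dem_remove_pos[OF j0] c_pos by (simp add: remove_plan_def plan_nth)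
    then have e: "0 < e" "e \<le> remove_plan j0 $ i' $ j"
      "(\<Sum>j\<in>UNIV. remove_plan j0 $ i $ j) + e \<le> max_over UNIV (\<lambda>j. d i j * ind (- {j0}) $ j)"
      using remove_plan_row_less[OF j0 i(1) dem(1)] by (auto simp: e_def simp del: ind_nth)
    define x1 where "x1 = remove_plan j0 + axis i' (axis j (- e))"
    note rp = remove_plan_in_chi[OF j0]
    have x1: "(x1, ind (- {j0})) \<in> chi c d"
      unfolding x1_def using e chiD(1)[OF rp, of j] chiD(2)[OF rp, of i']
      by (intro chi_add_entry rp) (auto simp del: ind_nth)
    have row: "(\<Sum>j\<in>UNIV. x1 $ i $ j) = (\<Sum>j\<in>UNIV. remove_plan j0 $ i $ j)"
      using False by (simp add: x1_def sum.distrib row_sum_axis)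
    have col: "(\<Sum>i\<in>UNIV. x1 $ i $ j) + e = (\<Sum>i\<in>UNIV. remove_plan j0 $ i $ j)"
      by (simp add: x1_def sum.distrib col_sum_axis)
    have "(x1 + axis i (axis j e), ind (- {j0})) \<in> chi c d"
      using e chiD(1)[OF rp, of j] chiD(3)[OF x1, of i j]
      by (intro chi_add_entry x1) (auto simp: row col simp del: ind_nth)
    then have "(x1 + axis i (axis j e), ind (- {j0})) \<in> tight"
      using i j j0 by (intro tight_removeI) (auto simp: x1_def sum.distrib remove_plan_block block_sum_axis)
    then have "A \<bullet> (x1 + axis i (axis j e)) + B \<bullet> ind (- {j0}) = 0"
      by (rule ann)
    then have "A $ i $ j * e = A $ i' $ j * e"
      using ann[OF remove_plan_tight[OF j0]] unfolding x1_def inner_add_right inner_axes by linarith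
    then show ?thesis
      using e by simp
  qed simp

  \<comment> \<open>With \<open>j0\<close> closed, row \<open>i\<close> has slack. Column
    \<open>j\<close> is open and empty in \<open>remove_plan j0\<close>, and it lies outside the
    block counted by \<open>lhs\<close>.\<close>
  have A_side: "A $ i $ j = 0"
    if j0: "j0 \<in> J" and i: "i \<in> I" and j: "j \<notin> J" "0 < c j" and dem: "0 < dem (J - {j0}) i" for i j j0
  proof -
    define e where "e = min (c j)
      (max_over UNIV (\<lambda>j. d i j * ind (- {j0}) $ j) - (\<Sum>j\<in>UNIV. remove_plan j0 $ i $ j))"
    have e: "0 < e"
      using remove_plan_row_less[OF j0 i dem] j by (simp add: e_def del: ind_nth)
    have "j \<noteq> j0"
      using j0 j by auto
    note rp = remove_plan_in_chi[OF j0]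
    have col: "(\<Sum>i\<in>UNIV. remove_plan j0 $ i $ j) = 0"
      using j by (simp add: remove_plan_def plan_col)
    have "c j * ind (- {j0}) $ j = c j"
      using \<open>j \<noteq> j0\<close> by simp
    then have "(remove_plan j0 + axis i (axis j e), ind (- {j0})) \<in> chi c d"
      using e chiD(3)[OF rp, of i j] by (intro chi_add_entry rp) (auto simp: col e_def simp del: ind_nth)
    then have "(remove_plan j0 + axis i (axis j e), ind (- {j0})) \<in> tight"
      using j0 j by (intro tight_removeI) (auto simp: sum.distrib remove_plan_block block_sum_axis)
    then have "A \<bullet> (remove_plan j0 + axis i (axis j e)) + B \<bullet> ind (- {j0}) = 0"
      by (rule ann)
    then have "A $ i $ j * e = 0"
      using ann[OF remove_plan_tight[OF j0]] unfolding inner_add_right inner_axes by linarith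
    then show ?thesis
      using e by simp
  qed

  obtain a b where ab: "a \<in> J" "b \<in> J" "a \<noteq> b"
    by (rule J_two_elements)
  obtain k where k: "k \<in> I" "0 < dem (J - {a}) k" "0 < dem (J - {b}) k"
    using exists_common_row[OF ab] .
  have kJ: "0 < dem J k"
    using k(2) dem_mono[of "J - {a}" J k] by auto
  define \<alpha> where "\<alpha> = A $ k $ a"
  \<comment> \<open>Deleting one of \<open>a\<close> and \<open>b\<close> leaves
    \<open>dem J i\<close> unchanged, and row \<open>k\<close> keeps positive demand under either
    deletion.\<close>
  have remove_row: "\<exists>j0\<in>J. 0 < dem (J - {j0}) i \<and> 0 < dem (J - {j0}) k" if "0 < dem J i" for i
    using max_over_Diff_cases[OF _ ab(3), of J "d i"] d_nonneg ab k that by (metis finite)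
  \<comment> \<open>The entry is linked to \<open>(k, a)\<close> in three moves: along row
    \<open>i\<close> to a column \<open>l\<close> other than \<open>j0\<close>, along that column to
    row \<open>k\<close>, and along row \<open>k\<close> to \<open>a\<close>.\<close>
  have A_in: "A $ i $ j = \<alpha>" if i: "i \<in> I" and j: "j \<in> J" and dem: "0 < dem J i" for i j
  proof -
    obtain j0 where j0: "j0 \<in> J" "0 < dem (J - {j0}) i" "0 < dem (J - {j0}) k"
      using remove_row[OF dem] by blast
    obtain l where l: "l \<in> J - {j0}"
      using J_remove_nonempty[OF j0(1)] by blast
    have "A $ i $ j = A $ i $ l"
      using A_row i j l dem by blast
    also have "\<dots> = A $ k $ l"
      using A_col[OF j0(1) l i k(1) j0(2,3)] .
    also have "\<dots> = \<alpha>"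
      unfolding \<alpha>_def using A_row k(1) l ab kJ by blast
    finally show ?thesis .
  qed

  have A_inner: "A \<bullet> x = \<alpha> * (\<Sum>i\<in>I. \<Sum>j\<in>J. x $ i $ j)" if z: "(x, y) \<in> chi c d" for x y
  proof -
    have "A $ i $ j * x $ i $ j = (if i \<in> I \<and> j \<in> J then \<alpha> * x $ i $ j else 0)" for i j
    \<comment> \<open>If column \<open>j\<close> has no capacity or row \<open>i\<close> no demand
      at all, the coordinate is zero at every point of \<open>chi c d\<close> and its coefficient is
      irrelevant.\<close>
    proof (cases "c j > 0 \<and> dem UNIV i > 0")
      case True
      then have *: "c j > 0" "dem UNIV i > 0" by auto
      show ?thesis
      proof (cases "i \<in> I")
        case iI: True
        then have dem: "0 < dem J i"
          using * dominated by simp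
        then show ?thesis
          using iI A_in[OF iI _ dem] A_side[OF _ iI _ *(1)] remove_row[OF dem] by fastforce
      qed (use A_out * in simp)
    next
      case False
      have "c j * y $ j \<le> 0" if "\<not> c j > 0"
        using that c_nonneg[of j] by simp
      moreover have "max_over UNIV (\<lambda>j. d i j * y $ j) \<le> dem UNIV i"
        using d_nonneg by (intro chi_row_cap_le[OF z]) auto
      ultimately have "x $ i $ j = 0"
        using False by (intro chi_entry_eq_0[OF z]) linarith
      then show ?thesis
        by simp
    qed
    then have "A \<bullet> x = (\<Sum>i\<in>UNIV. \<Sum>j\<in>UNIV. if i \<in> I \<and> j \<in> J then \<alpha> * x $ i $ j else 0)"
      by (simp add: inner_vec_def)
    also have "\<dots> = (\<Sum>i\<in>UNIV. if i \<in> I then \<Sum>j\<in>J. \<alpha> * x $ i $ j else 0)"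
      by (intro sum.cong) (auto simp: sum.If_cases)
    also have "\<dots> = \<alpha> * (\<Sum>i\<in>I. \<Sum>j\<in>J. x $ i $ j)"
      by (simp add: sum.If_cases sum_distrib_left)
    finally show ?thesis .
  qed

  have B_sum: "(\<Sum>j\<in>UNIV. B $ j) = - \<alpha> * D"
    using ann[OF full_plan_tight[of UNIV]] A_inner[OF full_plan_in_chi[of UNIV]]
    by (simp add: full_plan_block inner_ind)
  \<comment> \<open>Closing only \<open>j\<close> changes the sum of the
    \<open>B\<close>-coefficients by \<open>B $ j\<close>, so comparison with \<open>B_sum\<close>
    isolates it.\<close>
  have B_in: "B $ j = \<alpha> * (C - D - c j)" if "j \<in> J" for j
    using ann[OF remove_plan_tight[OF that]] A_inner[OF remove_plan_in_chi[OF that]] B_sum that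
    by (simp add: remove_plan_block sum_c_remove inner_ind Compl_eq_Diff_UNIV sum_diff1 algebra_simps)
  \<comment> \<open>Computing the sum of \<open>B\<close> a second time and equating it with
    \<open>- \<alpha> * D\<close> gives
    \<open>\<alpha> * (card J - 1) * (C - D) = 0\<close>.\<close>
  have "(\<Sum>j\<in>UNIV. B $ j) = (\<Sum>j\<in>J. B $ j)"
    using B_out by (intro sum.mono_neutral_right) auto
  also have "\<dots> = (\<Sum>j\<in>J. \<alpha> * (C - D - c j))"
    using B_in by simp
  also have "\<dots> = \<alpha> * (real (card J) * (C - D) - C)"
    by (simp add: sum_subtractf flip: sum_distrib_left)
  finally have "\<alpha> * rhs = 0"
    using B_sum by (simp add: rhs_def algebra_simps)
  then have "\<alpha> = 0"
    using rhs_pos by simp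
  then have "B = 0"
    using B_in B_out by (auto simp: vec_eq_iff)
  then show ?thesis
    using A_inner[OF z] \<open>\<alpha> = 0\<close> by simp
qed

theorem facet: "defines_facet (convex hull (chi c d)) lhs rhs"
proof (rule defines_facet_convex_hullI[where p = 0])
  show "0 \<in> chi c d"
    using zero_in_chi c_nonneg d_nonneg by (metis zero_prod_def)
  show "lhs 0 \<noteq> rhs"
    using rhs_pos linear_0[OF linear_lhs] by simp
  fix u :: "(real ^ 'n ^ 'm) \<times> (real ^ 'n)" and \<gamma>
  assume u: "\<forall>z\<in>chi c d. lhs z = rhs \<longrightarrow> u \<bullet> z = \<gamma>" and "u \<bullet> 0 = \<gamma>"
  then have \<gamma>: "\<gamma> = 0" by simp
  obtain A B where AB: "u = (A, B)" by (cases u)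
  have "A \<bullet> x + B \<bullet> y = 0" if "(x, y) \<in> chi c d" for x y
  proof (rule functional_vanishes[OF _ that])
    show "A \<bullet> x + B \<bullet> y = 0" if "(x, y) \<in> tight" for x y
      using u that by (auto simp: tight_def \<gamma> AB)
  qed
  then show "\<forall>z\<in>chi c d. u \<bullet> z = \<gamma>"
    by (auto simp: AB \<gamma>)
qed (fact linear_lhs valid_lhs)+

end

section \<open>The valid inequalities\<close>

text \<open>If \<open>j'\<close> is closed, its column is empty and the capacity of \<open>J\<close>
  bounds the flow; if it is open, the two capacity sums cancel and only the demand bound
  remains.\<close>

lemma valid_single_center:
  fixes c :: "'n::finite \<Rightarrow> real" and d :: "'m::finite \<Rightarrow> 'n \<Rightarrow> real"
  assumes c: "\<And>j. 0 \<le> c j" and d: "\<And>i j. 0 \<le> d i j" and j': "j' \<notin> J"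
  shows "valid_ineq (convex hull (chi c d))
          (\<lambda>(x, y). (\<Sum>i\<in>I. \<Sum>j\<in>J \<union> {j'}. x $ i $ j)
             - ((\<Sum>i\<in>I. max_over UNIV (d i)) - (\<Sum>j\<in>J. c j)) * y $ j')
          (\<Sum>j\<in>J. c j)"
proof (rule valid_ineq_convex_hull)
  show "linear (\<lambda>(x::real^'n^'m, y). (\<Sum>i\<in>I. \<Sum>j\<in>J \<union> {j'}. x $ i $ j)
             - ((\<Sum>i\<in>I. max_over UNIV (d i)) - (\<Sum>j\<in>J. c j)) * y $ j')"
    by (rule linearI) (auto simp: sum.distrib algebra_simps sum_distrib_left)
  have "(\<Sum>i\<in>I. \<Sum>j\<in>J \<union> {j'}. x $ i $ j)
      \<le> (\<Sum>j\<in>J. c j) + ((\<Sum>i\<in>I. max_over UNIV (d i)) - (\<Sum>j\<in>J. c j)) * y $ j'"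
    if z: "(x, y) \<in> chi c d" for x y
  proof (cases "y $ j' = 0")
    case True
    have "c j * y $ j \<le> c j" for j
      using c[of j] chiD(4)[OF z, of j] by auto
    then have "(\<Sum>j\<in>J. c j * y $ j) \<le> (\<Sum>j\<in>J. c j)"
      by (intro sum_mono)
    then show ?thesis
      using chi_sum_le_capacity[OF z, of "J \<union> {j'}" I] True j' by simp
  next
    case False
    then have "y $ j' = 1"
      using chiD(4)[OF z] by blast
    then show ?thesis
      using chi_sum_le[OF z d, of UNIV "J \<union> {j'}" I] by simp
  qed
  then show "valid_ineq (chi c d) (\<lambda>(x, y). (\<Sum>i\<in>I. \<Sum>j\<in>J \<union> {j'}. x $ i $ j)
             - ((\<Sum>i\<in>I. max_over UNIV (d i)) - (\<Sum>j\<in>J. c j)) * y $ j')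
          (\<Sum>j\<in>J. c j)"
    by (fastforce simp: valid_ineq_def)
qed

lemma valid_all_centers:
  fixes c :: "'n::finite \<Rightarrow> real" and d :: "'m::finite \<Rightarrow> 'n \<Rightarrow> real"
  assumes c: "\<And>j. 0 \<le> c j" and d: "\<And>i j. 0 \<le> d i j"
    and le: "(\<Sum>j\<in>J. c j) \<le> (\<Sum>i\<in>I. max_over J (d i))"
  shows "valid_ineq (convex hull (chi c d))
          (\<lambda>(x, y). (\<Sum>i\<in>I. \<Sum>j\<in>UNIV. x $ i $ j)
             - (\<Sum>j'\<in>UNIV - J. ((\<Sum>i\<in>I. max_over (J \<union> {j'}) (d i)) - (\<Sum>j\<in>J. c j)) * y $ j'))
          (\<Sum>j\<in>J. c j)"
proof (rule valid_ineq_convex_hull)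
  let ?C = "\<Sum>j\<in>J. c j"
  let ?M = "\<lambda>T. \<Sum>i\<in>I. max_over T (d i)"
  let ?f = "\<lambda>(x::real^'n^'m, y). (\<Sum>i\<in>I. \<Sum>j\<in>UNIV. x $ i $ j)
             - (\<Sum>j'\<in>UNIV - J. (?M (J \<union> {j'}) - ?C) * y $ j')"
  show "linear ?f"
    by (rule linearI) (auto simp: sum.distrib algebra_simps sum_distrib_left sum_subtractf)
  have "(\<Sum>i\<in>I. \<Sum>j\<in>UNIV. x $ i $ j) \<le> ?C + (\<Sum>j'\<in>UNIV - J. (?M (J \<union> {j'}) - ?C) * y $ j')"
    if z: "(x, y) \<in> chi c d" for x y
  proof -
    define S where "S = {j' \<in> UNIV - J. y $ j' = 1}"
    have y_out: "y $ j = 0" if "j \<notin> J \<union> S" for j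
      using chiD(4)[OF z, of j] that by (auto simp: S_def)
    have "(\<Sum>j'\<in>UNIV - J. (?M (J \<union> {j'}) - ?C) * y $ j') = (\<Sum>j'\<in>S. (?M (J \<union> {j'}) - ?C) * y $ j')"
      using y_out by (intro sum.mono_neutral_right) (auto simp: S_def)
    also have "\<dots> = (\<Sum>j'\<in>S. ?M (J \<union> {j'}) - ?C)"
      by (intro sum.cong) (auto simp: S_def)
    finally have rhs: "(\<Sum>j'\<in>UNIV - J. (?M (J \<union> {j'}) - ?C) * y $ j') = (\<Sum>j'\<in>S. ?M (J \<union> {j'}) - ?C)" .
    show ?thesis
    proof (cases "S = {}")
      case True
      have "(\<Sum>j\<in>UNIV. c j * y $ j) = (\<Sum>j\<in>J. c j * y $ j)"
        using y_out True by (intro sum.mono_neutral_right) auto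
      also have "\<dots> \<le> ?C"
      proof (rule sum_mono)
        show "c j * y $ j \<le> c j" for j
          using c[of j] chiD(4)[OF z, of j] by auto
      qed
      finally show ?thesis
        using chi_sum_le_capacity[OF z, of UNIV I] True rhs by simp
    next
      case False
      have "(\<Sum>i\<in>I. \<Sum>j\<in>UNIV. x $ i $ j) \<le> ?M (J \<union> S)"
        using y_out by (intro chi_sum_le[OF z d]) auto
      also have "\<dots> \<le> (\<Sum>i\<in>I. max_over J (d i) + (\<Sum>s\<in>S. max_over (J \<union> {s}) (d i) - max_over J (d i)))"
        using d by (intro sum_mono max_over_Un_sum_le) auto
      also have "\<dots> = ?M J + (\<Sum>s\<in>S. ?M (J \<union> {s}) - ?M J)"
        by (simp add: sum.distrib sum.swap[of _ S I] sum_subtractf sum_distrib_left)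
      \<comment> \<open>Replacing \<open>?M J\<close> by \<open>?C\<close> in the leading term and
        in all \<open>card S\<close> increments leaves \<open>card S - 1\<close> copies of the
        difference. Their contribution has the right sign by \<open>le\<close> and because
        \<open>S\<close> is nonempty.\<close>
      also have "\<dots> = (\<Sum>s\<in>S. ?M (J \<union> {s}) - ?C) + ?C - (real (card S) - 1) * (?M J - ?C)"
        by (simp add: sum_subtractf algebra_simps)
      also have "\<dots> \<le> (\<Sum>s\<in>S. ?M (J \<union> {s}) - ?C) + ?C"
      proof -
        have "0 \<le> (real (card S) - 1) * (?M J - ?C)"
          using le False by (intro mult_nonneg_nonneg) (auto simp: Suc_le_eq card_gt_0_iff)
        then show ?thesis by linarith
      qed
      finally show ?thesis
        using rhs by simp
    qed
  qed
  then show "valid_ineq (chi c d) ?f ?C"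
    by (fastforce simp: valid_ineq_def)
qed

theorem corollary1:
  fixes c :: "'n::finite \<Rightarrow> real" and d :: "'m::finite \<Rightarrow> 'n \<Rightarrow> real"
  assumes c_nonneg: "\<And>j. c j \<ge> 0"
    and d_nonneg: "\<And>i j. d i j \<ge> 0"
  shows
    "(\<forall>(I :: 'm set) (J :: 'n set) j'.
        J \<subset> UNIV \<longrightarrow> j' \<in> UNIV - J \<longrightarrow>
        valid_ineq (convex hull (chi c d))
          (\<lambda>(x, y). (\<Sum>i\<in>I. \<Sum>j\<in>J \<union> {j'}. x $ i $ j)
             - ((\<Sum>i\<in>I. max_over UNIV (\<lambda>j. d i j)) - (\<Sum>j\<in>J. c j)) * y $ j')
          (\<Sum>j\<in>J. c j))
     \<and>
     ((\<forall>i j. d i j > 0) \<longrightarrow>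
      (\<forall>(I :: 'm set) (J :: 'n set).
        J \<subset> UNIV \<longrightarrow>
        (\<Sum>j\<in>J. c j) \<le> (\<Sum>i\<in>I. max_over J (\<lambda>j. d i j)) \<longrightarrow>
        valid_ineq (convex hull (chi c d))
          (\<lambda>(x, y). (\<Sum>i\<in>I. \<Sum>j\<in>UNIV. x $ i $ j)
             - (\<Sum>j'\<in>UNIV - J.
                  ((\<Sum>i\<in>I. max_over (J \<union> {j'}) (\<lambda>j. d i j)) - (\<Sum>j\<in>J. c j)) * y $ j'))
          (\<Sum>j\<in>J. c j)))
     \<and>
     (\<forall>(I :: 'm set) (J :: 'n set).
        (\<Sum>j\<in>J. c j) > (\<Sum>i\<in>I. max_over J (\<lambda>j. d i j)) \<longrightarrow>
        (\<forall>i\<in>I. max_over UNIV (\<lambda>j. d i j) = max_over J (\<lambda>j. d i j)) \<longrightarrow>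
        (\<forall>j0\<in>J. (\<Sum>j\<in>J - {j0}. c j) < (\<Sum>i\<in>I. max_over (J - {j0}) (\<lambda>j. d i j))) \<longrightarrow>
        defines_facet (convex hull (chi c d))
          (\<lambda>(x, y). (\<Sum>i\<in>I. \<Sum>j\<in>J. x $ i $ j)
             + (\<Sum>j\<in>J. ((\<Sum>j'\<in>J - {j}. c j') - (\<Sum>i\<in>I. max_over J (\<lambda>j'. d i j'))) * y $ j))
          ((real (card J) - 1) * ((\<Sum>j\<in>J. c j) - (\<Sum>i\<in>I. max_over J (\<lambda>j'. d i j')))))"
proof (intro conjI allI impI)
  fix I :: "'m set" and J :: "'n set" and j'
  assume "j' \<in> UNIV - J"
  then show "valid_ineq (convex hull (chi c d))
          (\<lambda>(x, y). (\<Sum>i\<in>I. \<Sum>j\<in>J \<union> {j'}. x $ i $ j)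
             - ((\<Sum>i\<in>I. max_over UNIV (\<lambda>j. d i j)) - (\<Sum>j\<in>J. c j)) * y $ j')
          (\<Sum>j\<in>J. c j)"
    using assms by (intro valid_single_center) auto
next
  fix I :: "'m set" and J :: "'n set"
  assume "(\<Sum>j\<in>J. c j) \<le> (\<Sum>i\<in>I. max_over J (\<lambda>j. d i j))"
  then show "valid_ineq (convex hull (chi c d))
          (\<lambda>(x, y). (\<Sum>i\<in>I. \<Sum>j\<in>UNIV. x $ i $ j)
             - (\<Sum>j'\<in>UNIV - J.
                  ((\<Sum>i\<in>I. max_over (J \<union> {j'}) (\<lambda>j. d i j)) - (\<Sum>j\<in>J. c j)) * y $ j'))
          (\<Sum>j\<in>J. c j)"
    using assms by (intro valid_all_centers)
next
  fix I :: "'m set" and J :: "'n set"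
  assume "(\<Sum>j\<in>J. c j) > (\<Sum>i\<in>I. max_over J (\<lambda>j. d i j))"
    and "\<forall>i\<in>I. max_over UNIV (\<lambda>j. d i j) = max_over J (\<lambda>j. d i j)"
    and "\<forall>j0\<in>J. (\<Sum>j\<in>J - {j0}. c j) < (\<Sum>i\<in>I. max_over (J - {j0}) (\<lambda>j. d i j))"
  with assms interpret flow_cover c d I J
    by unfold_locales auto
  show "defines_facet (convex hull (chi c d))
          (\<lambda>(x, y). (\<Sum>i\<in>I. \<Sum>j\<in>J. x $ i $ j)
             + (\<Sum>j\<in>J. ((\<Sum>j'\<in>J - {j}. c j') - (\<Sum>i\<in>I. max_over J (\<lambda>j'. d i j'))) * y $ j))
          ((real (card J) - 1) * ((\<Sum>j\<in>J. c j) - (\<Sum>i\<in>I. max_over J (\<lambda>j'. d i j'))))"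
    using facet unfolding lhs_def rhs_def .
qed

end
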